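(* Let $0<H<1$, let $\sigma>0$ and $Z_0>0$ be constants, and let $(W_t^H)_{t\ge 0}$ be a fractional Brownian motion with Hurst parameter $H$. Assume that the function $f:[0,\infty)\times[0,\infty)\to\mathbb{R}$ is continuous and satisfies condition (D1) (stated in the context). Let $(Z_t)$ be the solution, up to its first visit to zero, of $$dZ_t=\frac{f(t,Z_t)}{2Z_t}\,dt+\frac{\sigma}{2}\,dW_t^H$$ with initial value $Z_0$, let $\tau=\inf\{t>0:Z_t=0\}$, and let $X_t=Z_t^2\,\mathbf 1_{[0,\tau)}(t)$, $t\ge0$, be the corresponding generalised fractional Cox-Ingersoll-Ross process. Then, up to the first time it hits zero (that is, for $t\in[0,\tau)$), $(X_t)$ satisfies $$X_t=X_0+\int_0^t f(s,\sqrt{X_s})\,ds+\sigma\int_0^t\sqrt{X_s}\circ dW_s^H,$$ where $\int_0^t\sqrt{X_s}\circ dW_s^H$ is the Stratonovich integral.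
   Context: Condition (D1) on $f$: the function $g:[0,\infty)\times(0,\infty)\to(-\infty,\infty)$ defined by $g(t,x)=f(t,x)/(2x)$ is continuous and admits a continuous partial derivative with respect to $x$ on $(0,\infty)$; in addition, there exists a number $x^*>0$ such that for every $x>x^*$, $g(t,x)<0$ for all $t\ge 0$. The fractional Brownian motion starts at $W_0^H=0$ and has almost surely continuous sample paths. The equation for $Z$ is understood pathwise in integral form: almost surely, $Z_t=Z_0+\frac12\int_0^t f(s,Z_s)Z_s^{-1}\,ds+\frac{\sigma}{2}W_t^H$ for $0\le t<\tau$ (with $\inf\emptyset=+\infty$). Under (D1) this equation has a unique solution which is continuous and positive up to the time $\tau$ of the first visit to $0$. Stratonovich integral: given two stochastic processes $(X_t)_{t\in[0,T]}$ and $(Y_t)_{t\in[0,T]}$, the pathwise Stratonovich integral $\int_0^T Y_s\circ dX_s$ is defined as the pathwise limit (when it exists) $$\lim_{n\to\infty}\sum_{i=1}^n\left(\frac{Y_{t_i}+Y_{t_{i-1}}}{2}\right)(X_{t_i}-X_{t_{i-1}}),$$ where $0=t_0<t_1<\dots<t_{n-1}<t_n=T$ is a partition of $[0,T]$ such that $\sup_{1\le i\le n}|t_i-t_{i-1}|\to0$ as $n\to\infty$. *)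

theory Defs
  imports "HOL-Probability.Probability"
begin

text \<open>Constants count as (degenerate) Gaussian random variables.\<close>

definition gaussian_rv :: "'a measure \<Rightarrow> ('a \<Rightarrow> real) \<Rightarrow> bool" where
  "gaussian_rv M X \<longleftrightarrow>
     X \<in> borel_measurable M \<and>
     ((\<exists>c. AE \<omega> in M. X \<omega> = c) \<or>
      (\<exists>\<mu> s. 0 < s \<and> distributed M lborel X (\<lambda>x. ennreal (normal_density \<mu> s x))))"

definition gaussian_process :: "'a measure \<Rightarrow> real set \<Rightarrow> (real \<Rightarrow> 'a \<Rightarrow> real) \<Rightarrow> bool" where
  "gaussian_process M T X \<longleftrightarrow>
     (\<forall>J c. finite J \<and> J \<subseteq> T \<longrightarrow> gaussian_rv M (\<lambda>\<omega>. \<Sum>t\<in>J. c t * X t \<omega>))"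

definition fractional_brownian_motion ::
    "'a measure \<Rightarrow> real \<Rightarrow> (real \<Rightarrow> 'a \<Rightarrow> real) \<Rightarrow> bool" where
  "fractional_brownian_motion M H W \<longleftrightarrow>
     gaussian_process M {0..} W \<and>
     (\<forall>t\<ge>0. (\<integral>\<omega>. W t \<omega> \<partial>M) = 0) \<and>
     (\<forall>s\<ge>0. \<forall>t\<ge>0. (\<integral>\<omega>. W s \<omega> * W t \<omega> \<partial>M) =
        (s powr (2 * H) + t powr (2 * H) - \<bar>t - s\<bar> powr (2 * H)) / 2) \<and>
     (AE \<omega> in M. W 0 \<omega> = 0) \<and>
     (AE \<omega> in M. continuous_on {0..} (\<lambda>t. W t \<omega>))"

text \<open>The continuity of the partial derivative is joint continuity in \<open>(t, x)\<close>.\<close>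

definition condition_D1 :: "(real \<Rightarrow> real \<Rightarrow> real) \<Rightarrow> bool" where
  "condition_D1 f \<longleftrightarrow>
     (let g = (\<lambda>t x. f t x / (2 * x)) in
        continuous_on ({0..} \<times> {0<..}) (\<lambda>(t, x). g t x) \<and>
        (\<exists>g'. (\<forall>t\<ge>0. \<forall>x>0. ((\<lambda>y. g t y) has_real_derivative g' t x) (at x)) \<and>
              continuous_on ({0..} \<times> {0<..}) (\<lambda>(t, x). g' t x)) \<and>
        (\<exists>x0>0. \<forall>x>x0. \<forall>t\<ge>0. g t x < 0))"

text \<open>The infimum is taken in \<^typ>\<open>ereal\<close>, so that it is \<open>\<infinity>\<close> for a path without positive zeros.\<close>

definition first_zero :: "(real \<Rightarrow> real) \<Rightarrow> ereal" where
  "first_zero z = Inf {ereal t | t. 0 < t \<and> z t = 0}"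

text \<open>
  The path \<open>z\<close> solves
  \<open>dz = f(t, z) / (2 z) dt + \<sigma> / 2 dw\<close>, \<open>z 0 = z0\<close>,
  up to its first visit to zero. Values of \<open>z\<close> after \<open>first_zero z\<close> are irrelevant.
  Continuity includes the time \<open>first_zero z\<close>, and if this time is finite the path does
  vanish there; otherwise a path that is cut off by a jump at an earlier time would qualify.
  For \<open>z0 > 0\<close>, positivity on \<open>[0, first_zero z)\<close> follows by the intermediate value theorem,
  hence for continuous \<open>f\<close> the integrand is continuous on \<open>[0, t]\<close>.
\<close>

definition solves_until_first_zero ::
    "(real \<Rightarrow> real \<Rightarrow> real) \<Rightarrow> real \<Rightarrow> real \<Rightarrow> (real \<Rightarrow> real) \<Rightarrow> (real \<Rightarrow> real) \<Rightarrow> bool" where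
  "solves_until_first_zero f \<sigma> z0 w z \<longleftrightarrow>
     z 0 = z0 \<and>
     continuous_on {t. 0 \<le> t \<and> ereal t \<le> first_zero z} z \<and>
     (\<forall>t. ereal t = first_zero z \<longrightarrow> z t = 0) \<and>
     (\<forall>t\<ge>0. ereal t < first_zero z \<longrightarrow>
        z t = z0 + 1 / 2 * integral {0..t} (\<lambda>s. f s (z s) / z s) + \<sigma> / 2 * w t)"

definition generalised_CIR :: "(real \<Rightarrow> real) \<Rightarrow> real \<Rightarrow> real" where
  "generalised_CIR z t = (z t)\<^sup>2 * indicator {s. 0 \<le> s \<and> ereal s < first_zero z} t"

definition is_partition :: "real \<Rightarrow> nat \<Rightarrow> (nat \<Rightarrow> real) \<Rightarrow> bool" where
  "is_partition T n p \<longleftrightarrow> p 0 = 0 \<and> p n = T \<and> (\<forall>i\<in>{1..n}. p (i - 1) < p i)"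

text \<open>The inserted \<open>0\<close> only matters for \<open>n = 0\<close>, the trivial partition of \<open>[0, 0]\<close>.\<close>

definition mesh :: "nat \<Rightarrow> (nat \<Rightarrow> real) \<Rightarrow> real" where
  "mesh n p = Max (insert 0 ((\<lambda>i. \<bar>p i - p (i - 1)\<bar>) ` {1..n}))"

definition stratonovich_sum ::
    "(real \<Rightarrow> real) \<Rightarrow> (real \<Rightarrow> real) \<Rightarrow> nat \<Rightarrow> (nat \<Rightarrow> real) \<Rightarrow> real" where
  "stratonovich_sum y x n p =
     (\<Sum>i = 1..n. (y (p i) + y (p (i - 1))) / 2 * (x (p i) - x (p (i - 1))))"

text \<open>
  The limit is required along every sequence of partitions whose mesh tends to zero; the
  \<open>k\<close>-th partition has \<open>n k\<close> subintervals.
\<close>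

definition has_stratonovich_integral ::
    "(real \<Rightarrow> real) \<Rightarrow> (real \<Rightarrow> real) \<Rightarrow> real \<Rightarrow> real \<Rightarrow> bool" where
  "has_stratonovich_integral y x T I \<longleftrightarrow>
     (\<forall>n p. (\<forall>k. is_partition T (n k) (p k)) \<and> (\<lambda>k. mesh (n k) (p k)) \<longlonglongrightarrow> 0 \<longrightarrow>
        (\<lambda>k. stratonovich_sum y x (n k) (p k)) \<longlonglongrightarrow> I)"

definition stratonovich_integrable :: "(real \<Rightarrow> real) \<Rightarrow> (real \<Rightarrow> real) \<Rightarrow> real \<Rightarrow> bool" where
  "stratonovich_integrable y x T \<longleftrightarrow> (\<exists>I. has_stratonovich_integral y x T I)"

definition stratonovich_integral :: "(real \<Rightarrow> real) \<Rightarrow> (real \<Rightarrow> real) \<Rightarrow> real \<Rightarrow> real" where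
  "stratonovich_integral y x T = (THE I. has_stratonovich_integral y x T I)"

end

theory Submission
  imports Defs
begin

text \<open>
  The identity is proved path by path: the equation itself expresses the noise through the
  solution. On \<open>[0, t]\<close> with
  \<open>t < \<tau>\<close> the path \<open>z\<close> is continuous and positive (lemma \<open>positive_before_first_zero\<close>), so
  \<open>h s = f s (z s) / z s\<close> is continuous there, and the equation can be solved for the noise:
  \<open>w = (2 / \<sigma>) z - (1 / \<sigma>) A + const\<close> with \<open>A s = \<integral>\<^sub>0\<^sup>s h\<close>.
  Stratonovich sums are linear in the integrator, so it suffices to integrate \<open>z\<close> against \<open>z\<close>
  and against \<open>A\<close>.

  Against itself, \<open>z\<close> gives the telescoping summands
  \<open>(z b + z a) / 2 * (z b - z a) = ((z b)\<^sup>2 - (z a)\<^sup>2) / 2\<close>, so every Stratonovich sum equals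
  \<open>((z t)\<^sup>2 - (z 0)\<^sup>2) / 2\<close> exactly (\<open>has_stratonovich_integral_self\<close>); this is the point at which
  the averaged endpoints remove the second order term for paths of arbitrary roughness. Against
  the continuously differentiable \<open>A\<close> the sums converge to
  \<open>\<integral>\<^sub>0\<^sup>t z s * h s ds = \<integral>\<^sub>0\<^sup>t f s (z s) ds\<close>
  (\<open>has_stratonovich_integral_indefinite_integral\<close>). Together,
  \<open>\<sigma> \<integral> z \<circ> dw = (z t)\<^sup>2 - (z 0)\<^sup>2 - \<integral>\<^sub>0\<^sup>t f s (z s) ds\<close>, which is the claim because
  \<open>sqrt X = z\<close> before \<open>\<tau>\<close>.
\<close>

section \<open>Partitions of an interval\<close>

lemma partition_mono:
  assumes "is_partition T n p" "i \<le> j" "j \<le> n"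
  shows "p i \<le> p j"
  using assms(2,3)
proof (induction j rule: dec_induct)
  case (step k)
  have "p (Suc k - 1) < p (Suc k)"
    using assms(1) step.prems unfolding is_partition_def by (metis atLeastAtMost_iff le_add1 plus_1_eq_Suc)
  with step show ?case by simp
qed simp

lemma partition_in_interval:
  assumes "is_partition T n p" "i \<le> n"
  shows "p i \<in> {0..T}"
  using partition_mono[OF assms(1), of 0 i] partition_mono[OF assms(1), of i n] assms
  by (auto simp: is_partition_def)

lemma partition_sum_increments:
  fixes g :: "real \<Rightarrow> real"
  assumes "is_partition T n p"
  shows "(\<Sum>i = 1..n. g (p i) - g (p (i - 1))) = g T - g 0"
  using sum_telescope''[of 0 n "\<lambda>i. g (p i)"] assms by (simp add: is_partition_def)

lemma increment_le_mesh:
  assumes "i \<in> {1..n}"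
  shows "\<bar>p i - p (i - 1)\<bar> \<le> mesh n p"
  unfolding mesh_def using assms by (intro Max_ge) auto

text \<open>
  A Stratonovich integral is a limit along all refining sequences of partitions, so its uniqueness
  rests on the existence of one such sequence. On a nondegenerate interval the uniform partitions
  serve; on \<open>[0, 0]\<close> only the partition with \<open>n = 0\<close> is available.
\<close>

lemma ex_refining_partitions:
  assumes "0 \<le> T"
  obtains n p where "\<And>k. is_partition T (n k) (p k)" "(\<lambda>k. mesh (n k) (p k)) \<longlonglongrightarrow> 0"
proof (cases "T = 0")
  case True
  have "is_partition T 0 (\<lambda>_. 0)" "mesh 0 (\<lambda>_. 0) = 0"
    using True by (auto simp: is_partition_def mesh_def)
  then show thesis by (intro that[of "\<lambda>_. 0" "\<lambda>_ _. 0"]) auto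
next
  case False
  define p where "p k i = T * real i / real (Suc k)" for k i :: nat
  have incr: "p k i - p k (i - 1) = T / real (Suc k)" if "i \<in> {1..Suc k}" for k i
    using that by (simp add: p_def of_nat_diff right_diff_distrib diff_divide_distrib[symmetric])
  have "is_partition T (Suc k) (p k)" for k
    unfolding is_partition_def
  proof (intro conjI ballI)
    fix i assume "i \<in> {1..Suc k}"
    then have "p k i - p k (i - 1) = T / real (Suc k)" by (rule incr)
    also have "\<dots> > 0" using assms False by simp
    finally show "p k (i - 1) < p k i" by simp
  qed (simp_all add: p_def del: of_nat_Suc)
  moreover have "(\<lambda>k. mesh (Suc k) (p k)) \<longlonglongrightarrow> 0"
  proof -
    have "(\<lambda>i. \<bar>p k i - p k (i - 1)\<bar>) ` {1..Suc k} = (\<lambda>_. T / real (Suc k)) ` {1..Suc k}" for k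
      using assms by (intro image_cong refl) (simp only: incr, simp)
    then have "mesh (Suc k) (p k) = T / real (Suc k)" for k
      using assms by (simp add: mesh_def max_def)
    then show ?thesis using LIMSEQ_Suc[OF lim_const_over_n[of T]] by simp
  qed
  ultimately show thesis by (rule that)
qed

section \<open>Calculus of pathwise Stratonovich integrals\<close>

lemma stratonovich_integral_unique:
  assumes "0 \<le> T" "has_stratonovich_integral y x T I"
  shows "stratonovich_integral y x T = I"
  unfolding stratonovich_integral_def
proof (rule the_equality)
  show "has_stratonovich_integral y x T I" by (rule assms(2))
next
  fix J assume J: "has_stratonovich_integral y x T J"
  obtain n p where "\<And>k. is_partition T (n k) (p k)" "(\<lambda>k. mesh (n k) (p k)) \<longlonglongrightarrow> 0"
    using ex_refining_partitions[OF assms(1)] by metis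
  then have "(\<lambda>k. stratonovich_sum y x (n k) (p k)) \<longlonglongrightarrow> I"
      "(\<lambda>k. stratonovich_sum y x (n k) (p k)) \<longlonglongrightarrow> J"
    using assms(2) J unfolding has_stratonovich_integral_def by metis+
  then show "J = I" by (metis LIMSEQ_unique)
qed

lemma has_stratonovich_integral_cong:
  assumes "has_stratonovich_integral y x T I"
    and "\<And>s. s \<in> {0..T} \<Longrightarrow> y s = y' s" "\<And>s. s \<in> {0..T} \<Longrightarrow> x s = x' s"
  shows "has_stratonovich_integral y' x' T I"
proof -
  have "stratonovich_sum y x n p = stratonovich_sum y' x' n p" if "is_partition T n p" for n p
    unfolding stratonovich_sum_def
  proof (rule sum.cong[OF refl])
    fix i assume "i \<in> {1..n}"
    then have "p i \<in> {0..T}" "p (i - 1) \<in> {0..T}"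
      using partition_in_interval[OF that] by auto
    then show "(y (p i) + y (p (i - 1))) / 2 * (x (p i) - x (p (i - 1)))
        = (y' (p i) + y' (p (i - 1))) / 2 * (x' (p i) - x' (p (i - 1)))"
      by (simp add: assms(2,3))
  qed
  note same = this
  show ?thesis
    unfolding has_stratonovich_integral_def
  proof (intro allI impI, elim conjE)
    fix n :: "nat \<Rightarrow> nat" and p
    assume part: "\<forall>k. is_partition T (n k) (p k)" and mesh: "(\<lambda>k. mesh (n k) (p k)) \<longlonglongrightarrow> 0"
    have "(\<lambda>k. stratonovich_sum y x (n k) (p k)) \<longlonglongrightarrow> I"
      using assms(1) part mesh unfolding has_stratonovich_integral_def by metis
    moreover have "(\<lambda>k. stratonovich_sum y x (n k) (p k)) = (\<lambda>k. stratonovich_sum y' x' (n k) (p k))"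
      using part same by (intro ext) metis
    ultimately show "(\<lambda>k. stratonovich_sum y' x' (n k) (p k)) \<longlonglongrightarrow> I" by metis
  qed
qed

text \<open>The additive constant accounts for an initial value: only increments of the integrator count.\<close>

lemma has_stratonovich_integral_affine_integrator:
  assumes "has_stratonovich_integral y u T I" "has_stratonovich_integral y v T J"
  shows "has_stratonovich_integral y (\<lambda>s. a * u s + b * v s + c) T (a * I + b * J)"
proof -
  have "stratonovich_sum y (\<lambda>s. a * u s + b * v s + c) n p
      = a * stratonovich_sum y u n p + b * stratonovich_sum y v n p" for n p
    unfolding stratonovich_sum_def sum_distrib_left sum.distrib[symmetric]
    by (intro sum.cong refl) (simp add: field_simps)
  note linear = this
  show ?thesis
    unfolding has_stratonovich_integral_def linear
  proof (intro allI impI tendsto_add tendsto_mult_left)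
    fix n p assume "(\<forall>k. is_partition T (n k) (p k)) \<and> (\<lambda>k. mesh (n k) (p k)) \<longlonglongrightarrow> 0"
    then show "(\<lambda>k. stratonovich_sum y u (n k) (p k)) \<longlonglongrightarrow> I"
      "(\<lambda>k. stratonovich_sum y v (n k) (p k)) \<longlonglongrightarrow> J"
      using assms unfolding has_stratonovich_integral_def by metis+
  qed
qed

text \<open>
  Average times increment is a difference of two squares, so the Stratonovich sum telescopes to the
  increment of \<open>y\<^sup>2 / 2\<close> whatever the partition, however rough \<open>y\<close> may be.
\<close>

lemma has_stratonovich_integral_self:
  "has_stratonovich_integral y y T (((y T)\<^sup>2 - (y 0)\<^sup>2) / 2)"
proof -
  have *: "stratonovich_sum y y n p = ((y T)\<^sup>2 - (y 0)\<^sup>2) / 2" if "is_partition T n p" for n p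
  proof -
    have "stratonovich_sum y y n p = (\<Sum>i = 1..n. (y (p i))\<^sup>2 / 2 - (y (p (i - 1)))\<^sup>2 / 2)"
      unfolding stratonovich_sum_def
      by (intro sum.cong refl) (simp add: field_simps power2_eq_square)
    also have "\<dots> = (y T)\<^sup>2 / 2 - (y 0)\<^sup>2 / 2"
      by (rule partition_sum_increments[OF that, where g = "\<lambda>s. (y s)\<^sup>2 / 2"])
    finally show ?thesis by (simp add: diff_divide_distrib)
  qed
  show ?thesis
    unfolding has_stratonovich_integral_def
  proof (intro allI impI, elim conjE)
    fix n :: "nat \<Rightarrow> nat" and p
    assume "\<forall>k. is_partition T (n k) (p k)"
    then have "(\<lambda>k. stratonovich_sum y y (n k) (p k)) = (\<lambda>_. ((y T)\<^sup>2 - (y 0)\<^sup>2) / 2)"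
      using * by (intro ext) metis
    then show "(\<lambda>k. stratonovich_sum y y (n k) (p k)) \<longlonglongrightarrow> ((y T)\<^sup>2 - (y 0)\<^sup>2) / 2"
      by (simp only: tendsto_const)
  qed
qed

lemma integral_increment:
  fixes h :: "real \<Rightarrow> real"
  assumes "continuous_on {0..T} h" "0 \<le> a" "a \<le> b" "b \<le> T"
  shows "integral {0..b} h - integral {0..a} h = integral {a..b} h"
proof -
  have "h integrable_on {0..b}"
    using assms by (intro integrable_continuous_interval continuous_on_subset[OF assms(1)]) auto
  from Henstock_Kurzweil_Integration.integral_combine[OF assms(2,3) this] show ?thesis by simp
qed

text \<open>
  On one subinterval, replacing \<open>y\<close> under the integral by the average of its end values costs at
  most the oscillation \<open>e\<close> of \<open>y\<close> times \<open>\<integral>\<bar>h\<bar> \<le> B * (b - a)\<close>. The bound is linear in \<open>b - a\<close>, so that it can be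
  summed over a partition.
\<close>

lemma stratonovich_summand_error:
  fixes y h :: "real \<Rightarrow> real"
  assumes y: "continuous_on {0..T} y" and h: "continuous_on {0..T} h"
    and ab: "0 \<le> a" "a \<le> b" "b \<le> T"
    and osc: "\<And>u v. u \<in> {a..b} \<Longrightarrow> v \<in> {a..b} \<Longrightarrow> \<bar>y u - y v\<bar> \<le> e"
    and B: "\<And>s. s \<in> {0..T} \<Longrightarrow> \<bar>h s\<bar> \<le> B"
  shows "\<bar>(y b + y a) / 2 * (integral {0..b} h - integral {0..a} h)
      - (integral {0..b} (\<lambda>s. y s * h s) - integral {0..a} (\<lambda>s. y s * h s))\<bar> \<le> e * B * (b - a)"
proof -
  define c where "c = (y b + y a) / 2"
  have sub: "{a..b} \<subseteq> {0..T}" using ab by auto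
  have hi: "h integrable_on {a..b}" and yhi: "(\<lambda>s. y s * h s) integrable_on {a..b}"
    using continuous_on_subset[OF y sub] continuous_on_subset[OF h sub]
    by (auto intro!: integrable_continuous_interval continuous_intros)
  have "c * (integral {0..b} h - integral {0..a} h)
      - (integral {0..b} (\<lambda>s. y s * h s) - integral {0..a} (\<lambda>s. y s * h s))
      = c * integral {a..b} h - integral {a..b} (\<lambda>s. y s * h s)"
    using integral_increment[OF h ab] integral_increment[OF continuous_on_mult[OF y h] ab] by simp
  also have "\<dots> = integral {a..b} (\<lambda>s. (c - y s) * h s)"
    using hi yhi by (simp add: left_diff_distrib Henstock_Kurzweil_Integration.integral_diff
        integrable_on_mult_right)
  finally have eq: "c * (integral {0..b} h - integral {0..a} h)
      - (integral {0..b} (\<lambda>s. y s * h s) - integral {0..a} (\<lambda>s. y s * h s))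
      = integral {a..b} (\<lambda>s. (c - y s) * h s)" .
  have "norm (integral {a..b} (\<lambda>s. (c - y s) * h s)) \<le> e * B * (b - a)"
  proof (rule integral_bound[OF ab(2)])
    show "continuous_on {a..b} (\<lambda>s. (c - y s) * h s)"
      using continuous_on_subset[OF y sub] continuous_on_subset[OF h sub]
      by (intro continuous_intros)
    show "norm ((c - y s) * h s) \<le> e * B" if s: "s \<in> {a..b}" for s
    proof -
      have "\<bar>y b - y s\<bar> \<le> e" "\<bar>y a - y s\<bar> \<le> e" using osc s ab by auto
      then have "\<bar>c - y s\<bar> \<le> e" unfolding c_def by (simp add: abs_le_iff field_simps)
      moreover have "\<bar>h s\<bar> \<le> B" using B s sub by blast
      ultimately show ?thesis by (simp add: abs_mult mult_mono')
    qed
  qed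
  with eq show ?thesis by (simp add: c_def)
qed

text \<open>
  Uniform continuity makes the oscillation of \<open>y\<close> small on all subintervals of a fine partition at
  once, and the errors of the summands then add up to at most \<open>e * B * T\<close>.
\<close>

lemma has_stratonovich_integral_indefinite_integral:
  fixes y h :: "real \<Rightarrow> real"
  assumes "0 \<le> T" and y: "continuous_on {0..T} y" and h: "continuous_on {0..T} h"
  shows "has_stratonovich_integral y (\<lambda>s. integral {0..s} h) T (integral {0..T} (\<lambda>s. y s * h s))"
  unfolding has_stratonovich_integral_def
proof (intro allI impI, elim conjE)
  fix n :: "nat \<Rightarrow> nat" and p :: "nat \<Rightarrow> nat \<Rightarrow> real"
  assume part: "\<forall>k. is_partition T (n k) (p k)" and mesh: "(\<lambda>k. mesh (n k) (p k)) \<longlonglongrightarrow> 0"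
  define A where "A s = integral {0..s} h" for s
  define G where "G s = integral {0..s} (\<lambda>s. y s * h s)" for s
  have "bounded (h ` {0..T})"
    using compact_continuous_image[OF h] by (simp add: compact_imp_bounded)
  then obtain B where B: "0 < B" "\<And>s. s \<in> {0..T} \<Longrightarrow> \<bar>h s\<bar> \<le> B"
    unfolding bounded_pos by auto
  show "(\<lambda>k. stratonovich_sum y (\<lambda>s. integral {0..s} h) (n k) (p k))
      \<longlonglongrightarrow> integral {0..T} (\<lambda>s. y s * h s)"
    unfolding A_def[symmetric] G_def[symmetric]
  proof (rule tendstoI)
    fix r :: real assume r: "0 < r"
    \<comment> \<open>The summand \<open>1\<close> covers the degenerate interval \<open>T = 0\<close> and makes the final bound strict.\<close>
    define e where "e = r / (B * (T + 1))"
    have e: "0 < e" using r B \<open>0 \<le> T\<close> by (simp add: e_def)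
    have "e * B * T = r * (T / (T + 1))" using B by (simp add: e_def)
    also have "\<dots> < r * 1" using r \<open>0 \<le> T\<close> by (intro mult_strict_left_mono) auto
    finally have eBT: "e * B * T < r" by simp
    have "uniformly_continuous_on {0..T} y"
      using y by (simp add: compact_uniformly_continuous)
    then obtain d where d: "0 < d"
      "\<And>u v. u \<in> {0..T} \<Longrightarrow> v \<in> {0..T} \<Longrightarrow> dist v u < d \<Longrightarrow> dist (y v) (y u) < e"
      unfolding uniformly_continuous_on_def using e by metis
    have close: "dist (stratonovich_sum y A m q) (G T) < r"
      if q: "is_partition T m q" and fine: "mesh m q < d" for m q
    proof -
      have err: "\<bar>(y (q i) + y (q (i - 1))) / 2 * (A (q i) - A (q (i - 1)))
          - (G (q i) - G (q (i - 1)))\<bar> \<le> e * B * (q i - q (i - 1))" if i: "i \<in> {1..m}" for i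
      proof -
        have q_in: "q i \<in> {0..T}" "q (i - 1) \<in> {0..T}"
          using partition_in_interval[OF q] i by auto
        have le: "q (i - 1) \<le> q i" using partition_mono[OF q] i by auto
        have short: "q i - q (i - 1) < d" using increment_le_mesh[OF i, of q] fine by simp
        have "\<bar>y u - y v\<bar> \<le> e" if "u \<in> {q (i - 1)..q i}" "v \<in> {q (i - 1)..q i}" for u v
        proof -
          have "u \<in> {0..T}" "v \<in> {0..T}" "dist u v < d"
            using that q_in short by (auto simp: dist_real_def abs_less_iff)
          then show ?thesis using d(2)[of v u] by (simp add: dist_real_def)
        qed
        then show ?thesis
          unfolding A_def G_def using q_in le B by (intro stratonovich_summand_error[OF y h]) auto
      qed
      have "stratonovich_sum y A m q - G T
          = (\<Sum>i = 1..m. (y (q i) + y (q (i - 1))) / 2 * (A (q i) - A (q (i - 1)))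
              - (G (q i) - G (q (i - 1))))"
        using partition_sum_increments[OF q, of G]
        by (simp add: stratonovich_sum_def sum_subtractf G_def)
      also have "\<bar>\<dots>\<bar> \<le> (\<Sum>i = 1..m. e * B * (q i - q (i - 1)))"
        using err by (intro order.trans[OF sum_abs] sum_mono)
      also have "\<dots> = e * B * T"
        using partition_sum_increments[OF q, of "\<lambda>s. s"] by (simp add: sum_distrib_left[symmetric])
      finally show ?thesis using eBT by (simp add: dist_real_def)
    qed
    have "\<forall>\<^sub>F k in sequentially. mesh (n k) (p k) < d"
      using mesh d(1) by (rule order_tendstoD)
    then show "\<forall>\<^sub>F k in sequentially. dist (stratonovich_sum y A (n k) (p k)) (G T) < r"
      by eventually_elim (use part close in blast)
  qed
qed

section \<open>The equation along a single path\<close>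

lemma positive_before_first_zero:
  assumes "continuous_on {0..t} z" "0 < z 0" "ereal t < first_zero z" "s \<in> {0..t}"
  shows "0 < z s"
proof (rule ccontr)
  assume "\<not> 0 < z s"
  moreover have "continuous_on {0..s} z"
    using assms by (intro continuous_on_subset[OF assms(1)]) auto
  ultimately obtain u where u: "0 \<le> u" "u \<le> s" "z u = 0"
    using IVT2'[of z s 0 0] assms by auto
  then have "0 < u" using assms(2) by (cases "u = 0") auto
  with u have "first_zero z \<le> ereal u"
    unfolding first_zero_def by (intro Inf_lower) auto
  also have "\<dots> \<le> ereal t" using u assms by simp
  finally show False using assms(3) by simp
qed

text \<open>
  Solving the equation for the driving path \<open>w\<close> turns the integral against \<open>w\<close> into one against
  \<open>z\<close> itself and one against the drift. The factor \<open>z\<close> of the integrand cancels the denominator of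
  the drift.
\<close>

lemma has_stratonovich_integral_driving_path:
  assumes "0 < \<sigma>" "0 \<le> t"
    and z: "continuous_on {0..t} z" and pos: "\<And>s. s \<in> {0..t} \<Longrightarrow> 0 < z s"
    and f: "continuous_on {0..t} (\<lambda>s. f s (z s))"
    and eq: "\<And>s. s \<in> {0..t} \<Longrightarrow>
      z s = z0 + 1 / 2 * integral {0..s} (\<lambda>r. f r (z r) / z r) + \<sigma> / 2 * w s"
  shows "has_stratonovich_integral z w t
    (((z t)\<^sup>2 - (z 0)\<^sup>2 - integral {0..t} (\<lambda>s. f s (z s))) / \<sigma>)"
proof -
  define h where "h s = f s (z s) / z s" for s
  have "continuous_on {0..t} h"
    unfolding h_def using z f pos by (intro continuous_on_divide) (auto simp: less_imp_neq[symmetric])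
  with assms have "has_stratonovich_integral z (\<lambda>s. integral {0..s} h) t
      (integral {0..t} (\<lambda>s. z s * h s))"
    by (intro has_stratonovich_integral_indefinite_integral)
  moreover have "integral {0..t} (\<lambda>s. z s * h s) = integral {0..t} (\<lambda>s. f s (z s))"
    using pos by (intro integral_cong) (auto simp: h_def less_imp_neq[symmetric])
  ultimately have strat: "has_stratonovich_integral z
      (\<lambda>s. 2 / \<sigma> * z s + (- 1 / \<sigma>) * integral {0..s} h + (- 2 * z0 / \<sigma>)) t
      (2 / \<sigma> * (((z t)\<^sup>2 - (z 0)\<^sup>2) / 2) + (- 1 / \<sigma>) * integral {0..t} (\<lambda>s. f s (z s)))"
    by (intro has_stratonovich_integral_affine_integrator has_stratonovich_integral_self) simp
  have w_eq: "2 / \<sigma> * z s + (- 1 / \<sigma>) * integral {0..s} h + (- 2 * z0 / \<sigma>) = w s"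
    if "s \<in> {0..t}" for s
  proof -
    have "2 * z s - integral {0..s} h - 2 * z0 = \<sigma> * w s"
      using eq[OF that] by (simp add: h_def[abs_def])
    then show ?thesis using \<open>0 < \<sigma>\<close> by (simp add: field_simps)
  qed
  have "has_stratonovich_integral z w t
      (2 / \<sigma> * (((z t)\<^sup>2 - (z 0)\<^sup>2) / 2) + (- 1 / \<sigma>) * integral {0..t} (\<lambda>s. f s (z s)))"
    by (rule has_stratonovich_integral_cong[OF strat refl w_eq])
  then show ?thesis by (simp add: diff_divide_distrib)
qed

lemma generalised_CIR_equation:
  assumes "0 < \<sigma>" "0 < z0"
    and f: "continuous_on ({0..} \<times> {0..}) (\<lambda>(t, x). f t x)"
    and sol: "solves_until_first_zero f \<sigma> z0 w z"
    and x: "\<And>s. x s = generalised_CIR z s"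
    and t: "0 \<le> t" "ereal t < first_zero z"
  shows "(\<lambda>s. f s (sqrt (x s))) integrable_on {0..t} \<and>
    stratonovich_integrable (\<lambda>s. sqrt (x s)) w t \<and>
    x t = x 0 + integral {0..t} (\<lambda>s. f s (sqrt (x s)))
      + \<sigma> * stratonovich_integral (\<lambda>s. sqrt (x s)) w t"
proof -
  have before: "ereal s < first_zero z" if "s \<in> {0..t}" for s
    using that t(2) by (simp add: order.strict_trans1[of "ereal s" "ereal t"])
  have z: "continuous_on {0..t} z"
  proof (rule continuous_on_subset)
    show "continuous_on {s. 0 \<le> s \<and> ereal s \<le> first_zero z} z"
      using sol by (simp add: solves_until_first_zero_def)
    show "{0..t} \<subseteq> {s. 0 \<le> s \<and> ereal s \<le> first_zero z}"
      using before by (auto intro: less_imp_le)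
  qed
  have "0 < z 0" using sol \<open>0 < z0\<close> by (simp add: solves_until_first_zero_def)
  then have pos: "0 < z s" if "s \<in> {0..t}" for s
    using positive_before_first_zero[OF z _ t(2) that] by simp
  have x_eq: "x s = (z s)\<^sup>2" if "s \<in> {0..t}" for s
    using before[OF that] that by (simp add: x generalised_CIR_def)
  have sqrt_x: "sqrt (x s) = z s" if "s \<in> {0..t}" for s
    using x_eq[OF that] pos[OF that] by simp
  have fz: "continuous_on {0..t} (\<lambda>s. f s (z s))"
  proof -
    have "continuous_on {0..t} (\<lambda>s. (s, z s))" using z by (intro continuous_intros)
    moreover have "(\<lambda>s. (s, z s)) ` {0..t} \<subseteq> {0..} \<times> {0..}"
      using pos by (auto intro: less_imp_le)
    ultimately show ?thesis using continuous_on_compose2[OF f, of "{0..t}" "\<lambda>s. (s, z s)"] by simp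
  qed
  have drift: "integral {0..t} (\<lambda>s. f s (sqrt (x s))) = integral {0..t} (\<lambda>s. f s (z s))"
    by (intro integral_cong) (simp add: sqrt_x)
  have "has_stratonovich_integral z w t
      (((z t)\<^sup>2 - (z 0)\<^sup>2 - integral {0..t} (\<lambda>s. f s (z s))) / \<sigma>)"
    using sol before
    by (intro has_stratonovich_integral_driving_path[where ?z0.0 = z0] assms(1) t(1) z pos fz)
      (auto simp: solves_until_first_zero_def)
  then have strat: "has_stratonovich_integral (\<lambda>s. sqrt (x s)) w t
      (((z t)\<^sup>2 - (z 0)\<^sup>2 - integral {0..t} (\<lambda>s. f s (z s))) / \<sigma>)"
    by (rule has_stratonovich_integral_cong) (simp_all add: sqrt_x)
  have "(\<lambda>s. f s (sqrt (x s))) integrable_on {0..t}"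
    using integrable_continuous_interval[OF fz] by (rule integrable_eq) (simp add: sqrt_x)
  moreover have "x t = x 0 + integral {0..t} (\<lambda>s. f s (sqrt (x s)))
      + \<sigma> * stratonovich_integral (\<lambda>s. sqrt (x s)) w t"
    using stratonovich_integral_unique[OF t(1) strat] x_eq[of t] x_eq[of 0] drift t(1) \<open>0 < \<sigma>\<close>
    by simp
  ultimately show ?thesis using strat unfolding stratonovich_integrable_def by blast
qed

section \<open>The generalised fractional Cox-Ingersoll-Ross equation\<close>

theorem theorem3p1:
  fixes M :: "'a measure"
    and H \<sigma> z0 :: real
    and f :: "real \<Rightarrow> real \<Rightarrow> real"
    and W Z X :: "real \<Rightarrow> 'a \<Rightarrow> real"
    and \<tau> :: "'a \<Rightarrow> ereal"
  assumes "prob_space M"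
    and "0 < H" and "H < 1"
    and "0 < \<sigma>" and "0 < z0"
    and "fractional_brownian_motion M H W"
    and "continuous_on ({0..} \<times> {0..}) (\<lambda>(t, x). f t x)"
    and "condition_D1 f"
    and "AE \<omega> in M. solves_until_first_zero f \<sigma> z0 (\<lambda>t. W t \<omega>) (\<lambda>t. Z t \<omega>)"
    and "\<And>\<omega>. \<tau> \<omega> = first_zero (\<lambda>t. Z t \<omega>)"
    and "\<And>t \<omega>. X t \<omega> = generalised_CIR (\<lambda>s. Z s \<omega>) t"
  shows "AE \<omega> in M. \<forall>t. 0 \<le> t \<and> ereal t < \<tau> \<omega> \<longrightarrow>
           (\<lambda>s. f s (sqrt (X s \<omega>))) integrable_on {0..t} \<and>
           stratonovich_integrable (\<lambda>s. sqrt (X s \<omega>)) (\<lambda>s. W s \<omega>) t \<and>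
           X t \<omega> = X 0 \<omega> + integral {0..t} (\<lambda>s. f s (sqrt (X s \<omega>)))
                     + \<sigma> * stratonovich_integral (\<lambda>s. sqrt (X s \<omega>)) (\<lambda>s. W s \<omega>) t"
  using assms(9)
proof (eventually_elim, intro allI impI, elim conjE)
  fix \<omega> t
  assume "solves_until_first_zero f \<sigma> z0 (\<lambda>t. W t \<omega>) (\<lambda>t. Z t \<omega>)" "0 \<le> t" "ereal t < \<tau> \<omega>"
  then show "(\<lambda>s. f s (sqrt (X s \<omega>))) integrable_on {0..t} \<and>
      stratonovich_integrable (\<lambda>s. sqrt (X s \<omega>)) (\<lambda>s. W s \<omega>) t \<and>
      X t \<omega> = X 0 \<omega> + integral {0..t} (\<lambda>s. f s (sqrt (X s \<omega>)))
        + \<sigma> * stratonovich_integral (\<lambda>s. sqrt (X s \<omega>)) (\<lambda>s. W s \<omega>) t"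
    by (intro generalised_CIR_equation[OF assms(4,5,7)]) (simp_all add: assms(10,11))
qed

end
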